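(* Let $\sqrt N$ have a continued fraction of the form $\sqrt N=[c_0,\overline{c_1,c_2,\ldots,c_2,c_1,2c_0}]$ with period length $l\ge 1$ and convergents $p_m/q_m$. Let $f(x)=x^2-N$ and denote by $(1/f)^{(d)}$ the $d$-th derivative of $1/f$. For every integer $d\ge1$, the order $d$ Householder method $$H(x)=x+d\,\frac{(1/f)^{(d-1)}(x)}{(1/f)^{(d)}(x)},$$ applied to the $(l-1)$st convergent $x=p_{l-1}/q_{l-1}$ of $\sqrt N$, yields the $(kl-1)$st convergent, where $k=d+1$; that is, $$H\!\left(\frac{p_{l-1}}{q_{l-1}}\right)=\frac{p_{(d+1)l-1}}{q_{(d+1)l-1}}.$$
   Context: The continued fraction is either the simple continued fraction of a real number (integer partial quotients $c_i$) or a continued fraction of a complex number with Gaussian integer partial quotients (e.g. the Hurwitz continued fraction). The displayed form means: $c_{i+l}=c_i$ for all $i\ge1$, $c_l=2c_0$, and $c_i=c_{l-i}$ for $1\le i\le l-1$. The convergents $p_m/q_m=[c_0,\ldots,c_m]$ (well defined, $q_m\neq0$ for $m\ge 0$, and converging to $\sqrt N$) are given by $$\begin{pmatrix} c_0 & 1 \\ 1 & 0 \end{pmatrix}\begin{pmatrix} c_1 & 1 \\ 1 & 0 \end{pmatrix}\cdots\begin{pmatrix} c_m & 1 \\ 1 & 0 \end{pmatrix}=\begin{pmatrix} p_m & p_{m-1} \\ q_m & q_{m-1} \end{pmatrix},\qquad m\ge0.$$ In this situation one has $p_{l-1}^2-Nq_{l-1}^2=(-1)^l$. *)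

theory Defs
  imports "HOL-Analysis.Analysis"
begin

definition cf_step :: "'a::semiring_1 \<Rightarrow> 'a^2^2" where
  "cf_step a = vector [vector [a, 1], vector [1, 0]]"

primrec cf_matrix :: "(nat \<Rightarrow> 'a::semiring_1) \<Rightarrow> nat \<Rightarrow> 'a^2^2" where
  "cf_matrix c 0 = cf_step (c 0)"
| "cf_matrix c (Suc m) = cf_matrix c m ** cf_step (c (Suc m))"

definition cf_num :: "(nat \<Rightarrow> 'a::semiring_1) \<Rightarrow> nat \<Rightarrow> 'a" where
  "cf_num c m = cf_matrix c m $ 1 $ 1"

definition cf_den :: "(nat \<Rightarrow> 'a::semiring_1) \<Rightarrow> nat \<Rightarrow> 'a" where
  "cf_den c m = cf_matrix c m $ 2 $ 1"

text \<open>The second column of the matrix product indeed consists of the preceding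
  numerator and denominator (for index 0 it is the column (1, 0)).\<close>

lemma cf_matrix_0:
  "cf_matrix c 0 = vector [vector [cf_num c 0, 1], vector [cf_den c 0, 0]]"
  by (simp add: cf_num_def cf_den_def cf_step_def vec_eq_iff forall_2)

lemma cf_matrix_Suc:
  "cf_matrix c (Suc m) =
     vector [vector [cf_num c (Suc m), cf_num c m], vector [cf_den c (Suc m), cf_den c m]]"
  by (simp add: cf_num_def cf_den_def cf_step_def vec_eq_iff forall_2
      matrix_matrix_mult_def sum_2)

definition cf_convergent :: "(nat \<Rightarrow> 'a::field) \<Rightarrow> nat \<Rightarrow> 'a" where
  "cf_convergent c m = cf_num c m / cf_den c m"

text \<open>All denominators of a simple continued fraction are positive, because the partial
  quotients after the first one are; no separate well-definedness condition is needed.\<close>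

definition simple_cf :: "(nat \<Rightarrow> int) \<Rightarrow> real \<Rightarrow> bool" where
  "simple_cf c x \<longleftrightarrow>
     (\<forall>i\<ge>1. c i \<ge> 1) \<and> cf_convergent (\<lambda>i. real_of_int (c i)) \<longlonglongrightarrow> x"

definition gaussian_ints :: "complex set" where
  "gaussian_ints = {z. Re z \<in> \<int> \<and> Im z \<in> \<int>}"

text \<open>No particular algorithm (such as Hurwitz's) is prescribed for the choice of the
  Gaussian partial quotients; only well-definedness and convergence are required.\<close>

definition gaussian_cf :: "(nat \<Rightarrow> complex) \<Rightarrow> complex \<Rightarrow> bool" where
  "gaussian_cf c z \<longleftrightarrow>
     (\<forall>i. c i \<in> gaussian_ints) \<and> (\<forall>m. cf_den c m \<noteq> 0) \<and> cf_convergent c \<longlonglongrightarrow> z"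

text \<open>The shape of a square root: initial term followed by the periodic
  block \<open>c\<^sub>1, c\<^sub>2, \<dots>, c\<^sub>2, c\<^sub>1, 2 c\<^sub>0\<close>, this block having length
  \<open>l\<close>. The period \<open>l\<close> is not required to be minimal.\<close>

definition sqrt_cf_shape :: "nat \<Rightarrow> (nat \<Rightarrow> 'a::semiring_1) \<Rightarrow> bool" where
  "sqrt_cf_shape l c \<longleftrightarrow>
     (\<forall>i\<ge>1. c (i + l) = c i) \<and> c l = 2 * c 0 \<and> (\<forall>i. 1 \<le> i \<and> i \<le> l - 1 \<longrightarrow> c i = c (l - i))"

definition householder :: "nat \<Rightarrow> ('a::real_normed_field \<Rightarrow> 'a) \<Rightarrow> 'a \<Rightarrow> 'a" where
  "householder d f x =
     x + of_nat d * ((deriv ^^ (d - 1)) (\<lambda>t. 1 / f t) x / (deriv ^^ d) (\<lambda>t. 1 / f t) x)"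

end

(* Write (x + sqrt N)^n = U_n + V_n sqrt N. The n-th derivative of 1/(x^2 - N) is
   (-1)^n n! V_(n+1) / (x^2 - N)^(n+1), so the Householder step of order d sends x to
   U_(d+1) / V_(d+1). On the other side, the palindromic shape of the period makes the matrix
   of the (k l - 1)st convergent have the same first column as B^k with B = ((p, r), (q, p)),
   p / q being the (l - 1)st convergent. Convergence forces r = N q, so B is multiplication
   by p + q sqrt N = q (x + sqrt N), and B^k has first column q^k (U_k, V_k). *)
theory Submission
  imports Defs
begin

section \<open>Powers of a quadratic surd and Householder steps\<close>

text \<open>The pair \<open>(U, V)\<close> with \<open>(x + sqrt N) ^ n = U + V * sqrt N\<close>; as a recursion it
  also makes sense for \<open>N = 0\<close>, which does occur over the Gaussian integers (e.g. \<open>c\<^sub>0 = \<i>\<close>,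
  \<open>l = 1\<close>).\<close>

primrec surd_pow :: "'a::comm_ring_1 \<Rightarrow> 'a \<Rightarrow> nat \<Rightarrow> 'a \<times> 'a" where
  "surd_pow N x 0 = (1, 0)"
| "surd_pow N x (Suc n) =
     (x * fst (surd_pow N x n) + N * snd (surd_pow N x n),
      fst (surd_pow N x n) + x * snd (surd_pow N x n))"

text \<open>The rule d/dx (x + sqrt N)^n = n (x + sqrt N)^(n-1), read coefficientwise. At n = 0 the
  truncated \<open>n - 1\<close> is harmless because of the factor \<open>of_nat n\<close>.\<close>

lemma surd_pow_has_field_derivative:
  fixes N x :: "'a::real_normed_field"
  shows "((\<lambda>x. fst (surd_pow N x n)) has_field_derivative
            of_nat n * fst (surd_pow N x (n - 1))) (at x) \<and>
         ((\<lambda>x. snd (surd_pow N x n)) has_field_derivative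
            of_nat n * snd (surd_pow N x (n - 1))) (at x)"
proof (induction n)
  case 0
  show ?case by simp
next
  case (Suc n)
  note [derivative_intros] = conjunct1[OF Suc.IH] conjunct2[OF Suc.IH]
  have "((\<lambda>x. fst (surd_pow N x (Suc n))) has_field_derivative
          (fst (surd_pow N x n) + x * (of_nat n * fst (surd_pow N x (n - 1)))
            + N * (of_nat n * snd (surd_pow N x (n - 1))))) (at x)"
       "((\<lambda>x. snd (surd_pow N x (Suc n))) has_field_derivative
          (of_nat n * fst (surd_pow N x (n - 1))
            + (snd (surd_pow N x n) + x * (of_nat n * snd (surd_pow N x (n - 1)))))) (at x)"
    by (auto intro!: derivative_eq_intros)
  then show ?case
    by (cases n) (simp_all add: algebra_simps)
qed

text \<open>If s^2 = N and s is nonzero, partial fractions produce ((x + s)^(n+1) - (x - s)^(n+1)) /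
  (2 s), which is V_(n+1). The induction never divides by s and so covers N = 0.\<close>

lemma higher_deriv_inverse_quadratic:
  fixes N x :: "'a::real_normed_field"
  assumes "x\<^sup>2 - N \<noteq> 0"
  shows "(deriv ^^ n) (\<lambda>t. 1 / (t\<^sup>2 - N)) x =
           (- 1) ^ n * fact n * snd (surd_pow N x (Suc n)) / (x\<^sup>2 - N) ^ Suc n"
  using assms
proof (induction n arbitrary: x)
  case 0
  then show ?case by simp
next
  case (Suc n)
  let ?g = "\<lambda>x. (- 1) ^ n * fact n * snd (surd_pow N x (Suc n)) / (x\<^sup>2 - N) ^ Suc n"
  let ?S = "{x :: 'a. x\<^sup>2 - N \<noteq> 0}"
  let ?f = "x\<^sup>2 - N" and ?U = "fst (surd_pow N x n)" and ?V = "snd (surd_pow N x n)"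
  define W where "W = snd (surd_pow N x (Suc n))"
  have W: "W = ?U + x * ?V" by (simp add: W_def)
  have "open ?S"
    by (intro open_Collect_neq continuous_intros)
  have V: "((\<lambda>x. snd (surd_pow N x (Suc n))) has_field_derivative of_nat (Suc n) * ?V) (at x)"
    using surd_pow_has_field_derivative[of N "Suc n" x] by simp
  have D: "((\<lambda>x. (x\<^sup>2 - N) ^ Suc n) has_field_derivative
              of_nat (Suc n) * ?f ^ n * (2 * x)) (at x)"
    by (rule DERIV_cong[OF DERIV_power_Suc[of "\<lambda>x. x\<^sup>2 - N" "2 * x"]])
      (auto intro!: derivative_eq_intros simp: algebra_simps)
  have "(?g has_field_derivative
          ((- 1) ^ n * fact n * (of_nat (Suc n) * ?V) * ?f ^ Suc n
            - (- 1) ^ n * fact n * W * (of_nat (Suc n) * ?f ^ n * (2 * x)))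
          / (?f ^ Suc n * ?f ^ Suc n)) (at x)"
    unfolding W_def
    by (rule DERIV_divide[OF DERIV_cmult[OF V] D]) (use Suc.prems in simp)
  also have "((- 1) ^ n * fact n * (of_nat (Suc n) * ?V) * ?f ^ Suc n
            - (- 1) ^ n * fact n * W * (of_nat (Suc n) * ?f ^ n * (2 * x)))
          = (- 1) ^ Suc n * fact (Suc n) * ((2 * x * W - ?f * ?V) * ?f ^ n)"
    by (simp add: algebra_simps)
  \<comment> \<open>V_(n+2) = 2 x V_(n+1) - (x^2 - N) V_n, because x + sqrt N is a root of T^2 - 2 x
    T + (x^2 - N).\<close>
  also have "2 * x * W - ?f * ?V = snd (surd_pow N x (Suc (Suc n)))"
    by (simp add: W algebra_simps power2_eq_square)
  also have "(- 1) ^ Suc n * fact (Suc n) * (snd (surd_pow N x (Suc (Suc n))) * ?f ^ n)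
               / (?f ^ Suc n * ?f ^ Suc n)
             = (- 1) ^ Suc n * fact (Suc n) * snd (surd_pow N x (Suc (Suc n))) / ?f ^ Suc (Suc n)"
    using Suc.prems by (simp add: divide_simps del: surd_pow.simps fact_Suc)
  finally have "((deriv ^^ n) (\<lambda>t. 1 / (t\<^sup>2 - N)) has_field_derivative
      (- 1) ^ Suc n * fact (Suc n) * snd (surd_pow N x (Suc (Suc n))) / ?f ^ Suc (Suc n)) (at x)"
    by (rule has_field_derivative_transform_within_open[OF _ \<open>open ?S\<close>])
      (use Suc in simp_all)
  then show ?case
    by (simp add: DERIV_imp_deriv del: surd_pow.simps fact_Suc power_Suc)
qed

text \<open>Signs and factorials cancel, leaving x - (x^2 - N) V_d / V_(d+1). Multiplying (x + sqrt
  N)^(d+1) by x - sqrt N shows (x^2 - N) V_d = x V_(d+1) - U_(d+1).\<close>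

lemma householder_quadratic:
  fixes N x :: "'a::real_normed_field"
  assumes "d \<ge> 1" and f: "x\<^sup>2 - N \<noteq> 0" and V: "snd (surd_pow N x (Suc d)) \<noteq> 0"
  shows "householder d (\<lambda>x. x\<^sup>2 - N) x = fst (surd_pow N x (Suc d)) / snd (surd_pow N x (Suc d))"
proof -
  obtain n where d: "d = Suc n"
    using \<open>d \<ge> 1\<close> by (cases d) auto
  let ?V = "\<lambda>n. snd (surd_pow N x n)"
  have "of_nat d * ((deriv ^^ (d - 1)) (\<lambda>t. 1 / (t\<^sup>2 - N)) x / (deriv ^^ d) (\<lambda>t. 1 / (t\<^sup>2 - N)) x)
          = - ((x\<^sup>2 - N) * ?V d / ?V (Suc d))"
  proof -
    have "of_nat d * (e * fact n * a / g ^ Suc n / (- e * (of_nat d * fact n) * b / g ^ Suc d))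
            = - (g * a / b)" if "e \<noteq> 0" "g \<noteq> 0" "b \<noteq> 0" for e a b g :: 'a
      using that d by (simp add: field_simps del: of_nat_Suc)
    from this[of "(- 1) ^ n" "x\<^sup>2 - N" "?V (Suc d)" "?V d"] f V
    have "of_nat d * ((- 1) ^ n * fact n * ?V d / (x\<^sup>2 - N) ^ Suc n
            / ((- 1) ^ d * fact d * ?V (Suc d) / (x\<^sup>2 - N) ^ Suc d))
          = - ((x\<^sup>2 - N) * ?V d / ?V (Suc d))"
      unfolding d by simp
    then show ?thesis
      by (simp only: higher_deriv_inverse_quadratic[OF f] d diff_Suc_1)
  qed
  then have "householder d (\<lambda>x. x\<^sup>2 - N) x = (x * ?V (Suc d) - (x\<^sup>2 - N) * ?V d) / ?V (Suc d)"
    using V by (simp add: householder_def diff_divide_distrib del: surd_pow.simps)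
  also have "x * ?V (Suc d) - (x\<^sup>2 - N) * ?V d = fst (surd_pow N x (Suc d))"
    by (simp add: algebra_simps power2_eq_square)
  finally show ?thesis .
qed

section \<open>Products of continued fraction matrices\<close>

text \<open>Indexing by lists turns splitting into periods and reversal into list
  operations.\<close>

definition cf_prod :: "'a::semiring_1 list \<Rightarrow> 'a^2^2" where
  "cf_prod xs = foldr (\<lambda>a M. cf_step a ** M) xs (mat 1)"

lemma cf_prod_Nil [simp]: "cf_prod [] = mat 1"
  and cf_prod_Cons [simp]: "cf_prod (a # xs) = cf_step a ** cf_prod xs"
  by (simp_all add: cf_prod_def)

lemma cf_prod_append: "cf_prod (xs @ ys) = cf_prod xs ** cf_prod ys"
  by (induction xs) (simp_all add: matrix_mul_assoc)

lemma cf_matrix_eq_cf_prod: "cf_matrix c m = cf_prod (map c [0..<Suc m])"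
  by (induction m) (simp_all add: cf_prod_append matrix_mul_assoc)

lemma transpose_cf_step: "transpose (cf_step a) = cf_step a"
  by (simp add: transpose_def cf_step_def vec_eq_iff forall_2)

lemma transpose_cf_prod:
  fixes xs :: "'a::comm_semiring_1 list"
  shows "transpose (cf_prod xs) = cf_prod (rev xs)"
  by (induction xs)
    (simp_all add: matrix_transpose_mul cf_prod_append transpose_cf_step)

lemma det_cf_prod:
  fixes xs :: "'a::comm_ring_1 list"
  shows "det (cf_prod xs) = (- 1) ^ length xs"
  by (induction xs) (simp_all add: det_mul, simp add: det_2 cf_step_def)

text \<open>The bottom row starts as (1, 0) and \<open>c 0\<close> never enters it; the induction
  carries both entries, the second being 0 at the start.\<close>

lemma cf_den_pos:
  assumes "\<forall>i\<ge>1. c i \<ge> (1 :: int)"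
  shows "cf_den (\<lambda>i. real_of_int (c i)) m > 0"
proof -
  let ?c = "\<lambda>i. real_of_int (c i)"
  have "cf_matrix ?c m $ 2 $ 1 > 0 \<and> cf_matrix ?c m $ 2 $ 2 \<ge> 0"
  proof (induction m)
    case 0
    show ?case by (simp add: cf_step_def)
  next
    case (Suc m)
    have "?c (Suc m) > 0"
      using assms[rule_format, of "Suc m"] by simp
    with Suc show ?case
      by (simp add: matrix_matrix_mult_def sum_2 cf_step_def add_pos_nonneg)
  qed
  then show ?thesis by (simp add: cf_den_def)
qed

section \<open>Palindromic periods\<close>

lemma sqrt_cf_shape_periodic:
  assumes "sqrt_cf_shape l c" and "i \<ge> 1"
  shows "c (i + k * l) = c i"
proof (induction k)
  case (Suc k)
  then show ?case
    using assms unfolding sqrt_cf_shape_def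
    by (metis add.assoc add.commute mult_Suc trans_le_add1)
qed simp

lemma sqrt_cf_shape_palindrome:
  assumes "sqrt_cf_shape l c"
  shows "rev (map c [1..<l]) = map c [1..<l]"
proof (rule nth_equalityI)
  fix i assume "i < length (rev (map c [1..<l]))"
  then have i: "i < l - 1" by simp
  then have "c (Suc i) = c (l - Suc i)"
    using assms unfolding sqrt_cf_shape_def by simp
  with i show "rev (map c [1..<l]) ! i = map c [1..<l] ! i"
    by (simp add: rev_nth Suc_diff_Suc)
qed simp

text \<open>\<open>R = transvection c\<^sub>0\<close> is inserted between the blocks because
  \<open>cf_step (2 c\<^sub>0) = R ** cf_step c\<^sub>0\<close>.\<close>

definition transvection :: "'a::semiring_1 \<Rightarrow> 'a^2^2" where
  "transvection a = vector [vector [1, a], vector [0, 1]]"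

lemma transvection_mult_cf_step: "transvection a ** cf_step b = cf_step (a + b)"
  by (simp add: transvection_def cf_step_def vec_eq_iff forall_2 matrix_matrix_mult_def sum_2
      add.commute)

text \<open>With X the product over the first period, each later period contributes R X.
  Reassociating X (R X)^(k+1) as (X R)^(k+1) X puts the fixed matrix X R on the left, where it acts
  on the first column.\<close>

lemma cf_matrix_add_period:
  fixes c :: "nat \<Rightarrow> 'a::comm_ring_1"
  assumes shape: "sqrt_cf_shape l c" and l: "l \<ge> 1"
  shows "cf_matrix c (Suc (Suc k) * l - 1) =
           (cf_matrix c (l - 1) ** transvection (c 0)) ** cf_matrix c (Suc k * l - 1)"
proof -
  let ?X = "\<lambda>k. cf_prod (map c [0..<Suc k * l])" and ?R = "transvection (c 0)"
  have X: "cf_matrix c (Suc k * l - 1) = ?X k" for k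
    using l by (simp add: cf_matrix_eq_cf_prod del: upt_Suc)
  have block0: "map c [0..<l] = c 0 # map c [1..<l]"
    using l by (simp add: upt_conv_Cons)
  have step: "?X (Suc k) = ?X k ** (?R ** ?X 0)" for k
  proof -
    have "map c [Suc k * l..<Suc (Suc k) * l] = 2 * c 0 # map c [1..<l]"
    proof (rule nth_equalityI)
      fix i assume "i < length (map c [Suc k * l..<Suc (Suc k) * l])"
      then have i: "i < l" by simp
      show "map c [Suc k * l..<Suc (Suc k) * l] ! i = (2 * c 0 # map c [1..<l]) ! i"
      proof (cases i)
        case 0
        \<comment> \<open>Periodicity begins at index 1, so the leading entry reduces to
          \<open>c l\<close>, which is 2 c_0, and not to \<open>c 0\<close>.\<close>
        have "c (l + k * l) = c l"
          using sqrt_cf_shape_periodic[OF shape l] .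
        then show ?thesis
          using 0 l shape by (simp add: sqrt_cf_shape_def)
      next
        case (Suc j)
        then show ?thesis
          using i sqrt_cf_shape_periodic[OF shape, of i "Suc k"] by (simp add: add_ac)
      qed
    qed (use l in simp)
    moreover have "[0..<Suc (Suc k) * l] = [0..<Suc k * l] @ [Suc k * l..<Suc (Suc k) * l]"
      using upt_add_eq_append[of 0 "Suc k * l" l] by (simp add: add_ac)
    ultimately have "?X (Suc k) = ?X k ** (cf_step (c 0 + c 0) ** cf_prod (map c [1..<l]))"
      by (simp only: map_append cf_prod_append cf_prod_Cons mult_2)
    moreover have "?R ** ?X 0 = cf_step (c 0 + c 0) ** cf_prod (map c [1..<l])"
      by (simp add: block0 matrix_mul_assoc transvection_mult_cf_step)
    ultimately show ?thesis
      by (simp only:)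
  qed
  have "?X (Suc k) = (?X 0 ** ?R) ** ?X k"
  proof (induction k)
    case 0
    show ?case using step[of 0] by (simp add: matrix_mul_assoc)
  next
    case (Suc k)
    have "?X (Suc (Suc k)) = ?X (Suc k) ** (?R ** ?X 0)"
      by (rule step)
    also have "\<dots> = (?X 0 ** ?R) ** (?X k ** (?R ** ?X 0))"
      by (simp only: Suc matrix_mul_assoc)
    finally show ?case
      by (simp only: step[symmetric])
  qed
  moreover have "cf_matrix c (l - 1) = ?X 0"
    using X[of 0] by simp
  ultimately show ?thesis
    by (simp only: X)
qed

text \<open>The equality of the diagonal entries is where the symmetry of the period enters.\<close>

lemma cf_matrix_mult_transvection:
  fixes c :: "nat \<Rightarrow> 'a::comm_ring_1"
  assumes shape: "sqrt_cf_shape l c" and l: "l \<ge> 1"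
  obtains r where
    "cf_matrix c (l - 1) ** transvection (c 0) =
       vector [vector [cf_num c (l - 1), r], vector [cf_den c (l - 1), cf_num c (l - 1)]]"
    and "(cf_num c (l - 1))\<^sup>2 - r * cf_den c (l - 1) = (- 1) ^ l"
proof -
  define S where "S = cf_prod (map c [1..<l])"
  let ?B = "cf_matrix c (l - 1) ** transvection (c 0)"
  have P: "cf_matrix c (l - 1) = cf_step (c 0) ** S"
    using l by (simp add: cf_matrix_eq_cf_prod S_def upt_conv_Cons del: upt_Suc)
  have "transpose S = S"
    by (simp only: S_def transpose_cf_prod sqrt_cf_shape_palindrome[OF shape])
  then have "S $ 1 $ 2 = transpose S $ 1 $ 2"
    by simp
  then have "S $ 1 $ 2 = S $ 2 $ 1"
    by (simp only: transpose_def vec_lambda_beta)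
  \<comment> \<open>The top left entry is c_0 S_11 + S_21, the bottom right one c_0 S_11 +
    S_12.\<close>
  then have B: "?B = vector [vector [cf_num c (l - 1), ?B $ 1 $ 2],
                             vector [cf_den c (l - 1), cf_num c (l - 1)]]"
    unfolding cf_num_def cf_den_def P
    by (simp add: cf_step_def transvection_def vec_eq_iff forall_2 matrix_matrix_mult_def sum_2
        algebra_simps)
  have "det ?B = (- 1) ^ l"
    using l by (simp add: det_mul cf_matrix_eq_cf_prod det_cf_prod del: upt_Suc)
      (simp add: det_2 transvection_def)
  moreover have "det ?B = (cf_num c (l - 1))\<^sup>2 - ?B $ 1 $ 2 * cf_den c (l - 1)"
    by (subst B) (simp add: det_2 power2_eq_square)
  ultimately show ?thesis
    using that[OF B] by simp
qed

text \<open>A general normed field serves the real and the Gaussian case at once; \<open>s\<close>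
  is whichever root of N the convergents approach.\<close>

lemma householder_cf_convergent:
  fixes N s :: "'a::real_normed_field" and c :: "nat \<Rightarrow> 'a"
  assumes l: "l \<ge> 1" and d: "d \<ge> 1" and s: "s\<^sup>2 = N"
    and den: "\<And>m. cf_den c m \<noteq> 0" and lim: "cf_convergent c \<longlonglongrightarrow> s"
    and shape: "sqrt_cf_shape l c"
  shows "householder d (\<lambda>x. x\<^sup>2 - N) (cf_convergent c (l - 1)) = cf_convergent c ((d + 1) * l - 1)"
proof -
  define p q where "p = cf_num c (l - 1)" and "q = cf_den c (l - 1)"
  obtain r where B: "cf_matrix c (l - 1) ** transvection (c 0) = vector [vector [p, r], vector [q, p]]"
    and det: "p\<^sup>2 - r * q = (- 1) ^ l"
    using cf_matrix_mult_transvection[OF shape l] unfolding p_def q_def by metis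
  define P Q where "P = (\<lambda>k. cf_num c (Suc k * l - 1))" and "Q = (\<lambda>k. cf_den c (Suc k * l - 1))"
  have P_Suc: "P (Suc k) = p * P k + r * Q k" and Q_Suc: "Q (Suc k) = q * P k + p * Q k" for k
    unfolding P_def Q_def cf_num_def cf_den_def
    by (simp_all only: cf_matrix_add_period[OF shape l] B)
      (simp_all add: matrix_matrix_mult_def sum_2)
  have Q0: "Q k \<noteq> 0" for k
    by (simp add: Q_def den)
  define X where "X = (\<lambda>k. P k / Q k)"
  have X: "X k = cf_convergent c (Suc k * l - 1)" for k
    by (simp add: X_def P_def Q_def cf_convergent_def)
  have "strict_mono (\<lambda>k. Suc k * l - 1)"
    using l by (intro strict_monoI_Suc) simp
  from LIMSEQ_subseq_LIMSEQ[OF lim this] have Xlim: "X \<longlonglongrightarrow> s"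
    by (simp only: o_def flip: X)
  \<comment> \<open>B acts as a Moebius map taking X_k to X_(k+1). Clearing the denominator lets the
    limit pass without knowing that q s + p is nonzero.\<close>
  have "X (Suc k) * (q * X k + p) = p * X k + r" for k
  proof -
    have "q * X k + p = Q (Suc k) / Q k" "p * X k + r = P (Suc k) / Q k"
      using Q0[of k] by (simp_all add: X_def P_Suc Q_Suc add_divide_distrib)
    then show ?thesis
      using Q0[of "Suc k"] by (simp add: X_def)
  qed
  moreover have "(\<lambda>k. X (Suc k) * (q * X k + p)) \<longlonglongrightarrow> s * (q * s + p)"
    by (intro tendsto_intros Xlim LIMSEQ_Suc)
  moreover have "(\<lambda>k. p * X k + r) \<longlonglongrightarrow> p * s + r"
    by (intro tendsto_intros Xlim)
  ultimately have "s * (q * s + p) = p * s + r"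
    using LIMSEQ_unique by simp
  then have r: "r = N * q"
    using s by (simp add: algebra_simps power2_eq_square)
  define x where "x = p / q"
  have q: "q \<noteq> 0" and p: "p = q * x"
    by (simp_all add: q_def den x_def)
  \<comment> \<open>\<open>P 0\<close> and \<open>Q 0\<close> already belong to one full period,
    hence the exponent \<open>Suc k\<close>.\<close>
  have "P k = q ^ Suc k * fst (surd_pow N x (Suc k)) \<and>
        Q k = q ^ Suc k * snd (surd_pow N x (Suc k))" for k
  proof (induction k)
    case 0
    show ?case using p by (simp add: P_def Q_def p_def q_def)
  next
    case (Suc k)
    then show ?case
      by (simp add: P_Suc Q_Suc r p algebra_simps)
  qed
  note PQ = this[of d]
  \<comment> \<open>The determinant of B is a unit, which keeps x from being a root of f.\<close>
  have "(x\<^sup>2 - N) * q\<^sup>2 = (- 1) ^ l"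
    using det by (simp add: p r algebra_simps power2_eq_square)
  then have "x\<^sup>2 - N \<noteq> 0"
    by (metis mult_zero_left power_eq_0_iff neg_equal_0_iff_equal one_neq_zero)
  moreover have "snd (surd_pow N x (Suc d)) \<noteq> 0"
    using PQ Q0[of d] by (metis mult_zero_right)
  ultimately have "householder d (\<lambda>x. x\<^sup>2 - N) x
      = fst (surd_pow N x (Suc d)) / snd (surd_pow N x (Suc d))"
    by (intro householder_quadratic d)
  also have "\<dots> = X d"
    using PQ q by (simp add: X_def del: surd_pow.simps)
  finally show ?thesis
    by (simp add: X x_def p_def q_def cf_convergent_def)
qed

theorem theorem5p1:
  fixes l d :: nat
  assumes "l \<ge> 1" and "d \<ge> 1"
  shows "(\<forall>(N::real) (c :: nat \<Rightarrow> int).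
            N \<ge> 0 \<longrightarrow> simple_cf c (sqrt N) \<longrightarrow> sqrt_cf_shape l c \<longrightarrow>
            householder d (\<lambda>x. x\<^sup>2 - N) (cf_convergent (\<lambda>i. real_of_int (c i)) (l - 1))
              = cf_convergent (\<lambda>i. real_of_int (c i)) ((d + 1) * l - 1)) \<and>
         (\<forall>(N::complex) (s::complex) (c :: nat \<Rightarrow> complex).
            s\<^sup>2 = N \<longrightarrow> gaussian_cf c s \<longrightarrow> sqrt_cf_shape l c \<longrightarrow>
            householder d (\<lambda>x. x\<^sup>2 - N) (cf_convergent c (l - 1))
              = cf_convergent c ((d + 1) * l - 1))"
proof (intro conjI allI impI)
  fix N :: real and c :: "nat \<Rightarrow> int"
  assume N: "N \<ge> 0" and cf: "simple_cf c (sqrt N)" and shape: "sqrt_cf_shape l c"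
  have "sqrt_cf_shape l (\<lambda>i. real_of_int (c i))"
    using shape by (simp add: sqrt_cf_shape_def)
  \<comment> \<open>Positivity of the partial quotients supplies what \<open>gaussian_cf\<close>
    postulates.\<close>
  moreover have "cf_den (\<lambda>i. real_of_int (c i)) m \<noteq> 0" for m
    using cf cf_den_pos[of c m] by (simp add: simple_cf_def)
  ultimately show "householder d (\<lambda>x. x\<^sup>2 - N) (cf_convergent (\<lambda>i. real_of_int (c i)) (l - 1))
      = cf_convergent (\<lambda>i. real_of_int (c i)) ((d + 1) * l - 1)"
    using N cf assms by (intro householder_cf_convergent[where s = "sqrt N"])
      (auto simp: simple_cf_def)
next
  fix N s :: complex and c :: "nat \<Rightarrow> complex"
  assume "s\<^sup>2 = N" "gaussian_cf c s" "sqrt_cf_shape l c"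
  then show "householder d (\<lambda>x. x\<^sup>2 - N) (cf_convergent c (l - 1))
      = cf_convergent c ((d + 1) * l - 1)"
    using assms by (intro householder_cf_convergent[where s = s]) (auto simp: gaussian_cf_def)
qed

end
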